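(* For every $n\geq 1$, there are as many inversion sequences of size $n$ avoiding both patterns $210$ and $100$ as plane permutations of size $n$. In other words, $|\mathbf{I}_n(210,100)|=SB_n$.
   Context: An inversion sequence of size $n$ is an integer sequence $(e_1,\dots,e_n)$ with $0\leq e_i<i$ for all $i$. It contains a pattern $q=q_1\cdots q_k$ if there are indices $1\leq i_1<\dots<i_k\leq n$ such that $e_{i_1}\cdots e_{i_k}$ is order-isomorphic to $q$ (equal entries of $q$ corresponding to equal entries); otherwise it avoids $q$. $\mathbf{I}_n(210,100)$ is the set of inversion sequences of size $n$ avoiding both $210$ and $100$. A permutation $\pi=\pi_1\cdots\pi_n$ of $\{1,\dots,n\}$ is plane if there are no indices $i<j$ and $k>j+1$ with $\pi_{j}<\pi_i<\pi_k<\pi_{j+1}$. $SB_n$ denotes the number of semi-Baxter permutations of size $n$, i.e. permutations $\pi$ of $\{1,\dots,n\}$ with no indices $i<j$ and $k>j+1$ such that $\pi_{j+1}<\pi_i<\pi_k<\pi_j$; $SB_n$ is also the number of plane permutations of size $n$. *)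

theory Defs
  imports
    "HOL-Library.Sublist"
    "HOL-Combinatorics.Multiset_Permutations"
begin

text \<open>
  Sequences are lists, so positions are counted from 0: the entry written \<open>e\<^sub>i\<close> with
  \<open>1 \<le> i \<le> n\<close> is \<open>e ! (i - 1)\<close>, and the bound \<open>e\<^sub>i < i\<close> becomes \<open>e ! i \<le> i\<close> for \<open>i < n\<close>.
\<close>

definition inversion_sequences :: "nat \<Rightarrow> nat list set" where
  "inversion_sequences n = {e. length e = n \<and> (\<forall>i<n. e ! i \<le> i)}"

definition order_isomorphic :: "nat list \<Rightarrow> nat list \<Rightarrow> bool" where
  "order_isomorphic xs ys \<longleftrightarrow> length xs = length ys \<and>
     (\<forall>i<length xs. \<forall>j<length xs.
        (xs ! i < xs ! j \<longleftrightarrow> ys ! i < ys ! j) \<and> (xs ! i = xs ! j \<longleftrightarrow> ys ! i = ys ! j))"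

definition contains_pattern :: "nat list \<Rightarrow> nat list \<Rightarrow> bool" where
  "contains_pattern e q \<longleftrightarrow> (\<exists>s. subseq s e \<and> order_isomorphic s q)"

definition inversion_sequences_avoiding :: "nat list set \<Rightarrow> nat \<Rightarrow> nat list set" where
  "inversion_sequences_avoiding Q n =
     {e \<in> inversion_sequences n. \<forall>q\<in>Q. \<not> contains_pattern e q}"

text \<open>
  Permutations of \<open>{1..n}\<close> are in one-line notation, i.e. the lists in
  \<open>permutations_of_set {1..n}\<close>. The entries at \<open>j\<close> and \<open>j + 1\<close> are adjacent in both
  definitions below (vincular patterns 2-14-3 and 2-41-3 respectively).
\<close>

definition plane_permutations :: "nat \<Rightarrow> nat list set" where
  "plane_permutations n = {p \<in> permutations_of_set {1..n}.
     \<not> (\<exists>i j k. i < j \<and> j + 1 < k \<and> k < n \<and>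
          p ! j < p ! i \<and> p ! i < p ! k \<and> p ! k < p ! (j + 1))}"

definition semi_baxter_permutations :: "nat \<Rightarrow> nat list set" where
  "semi_baxter_permutations n = {p \<in> permutations_of_set {1..n}.
     \<not> (\<exists>i j k. i < j \<and> j + 1 < k \<and> k < n \<and>
          p ! (j + 1) < p ! i \<and> p ! i < p ! k \<and> p ! k < p ! j)}"

definition SB :: "nat \<Rightarrow> nat" where
  "SB n = card (semi_baxter_permutations n)"

end

theory Submission
  imports Defs
begin

text \<open>
  All three families are generated by appending a rightmost entry, and in all three an object
  can be given a label \<open>(h, k)\<close> such that the root has label \<open>(1, 1)\<close> and the children of an object
  with label \<open>(h, k)\<close> have exactly the labels
  \<open>(1, k + 1), \<dots>, (h, k + 1)\<close> and \<open>(h + 1, k), (h + 2, k - 1), \<dots>, (h + k, 1)\<close>.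
  This succession rule determines the number of objects of each size, so the three counts agree.
  The link is \<open>card_eq_tree_level\<close>; it is instantiated by \<open>card_avoiders\<close>,
  \<open>card_vincular_avoiders_up\<close> and \<open>card_vincular_avoiders_down\<close>.

  An inversion sequence avoids 210 and 100 iff no entry has a larger entry before it and
  a smaller or equal one after it. So a new last entry \<open>v\<close>
  is admissible iff it exceeds every \<^emph>\<open>dip\<close>, an entry with a larger one to its left. If \<open>M\<close> is the
  maximum, the values from \<open>M\<close> to \<open>n\<close> create no dip and are always admissible, while an admissible
  \<open>v < M\<close> becomes a new dip that disables the values up to \<open>v\<close>. The label is
  \<open>h = 1 + \<close> (number of admissible values below \<open>M\<close>) and \<open>k = n - M\<close>.

  For permutations, appending \<open>a\<close> raises the entries from \<open>a\<close> on by one. A value \<open>a\<close> is an active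
  site if appending it creates no forbidden pattern, where \<open>a\<close> would play the last letter, 3.
  Appending \<open>a\<close> splits the site \<open>a\<close> into \<open>a\<close> and \<open>a + 1\<close> and shifts the larger ones.
  Only the adjacency between the old last entry \<open>l\<close> and \<open>a\<close> is new. For 2-14-3 it matters when
  \<open>a > l\<close>, and then the new sites strictly above \<open>l + 1\<close> and at most \<open>a\<close> die; for 2-41-3 it
  matters when \<open>a \<le> l\<close>, and then the new sites strictly above \<open>a + 1\<close> and at most \<open>l + 1\<close> die.
  All other sites stay active. Counting the active sites at most \<open>l\<close> and those above \<open>l\<close> gives
  the label, with the two numbers in opposite roles for the two patterns.
\<close>

section \<open>The semi-Baxter succession rule\<close>

text \<open>
  The number of descendants \<open>m\<close> generations below a node with label \<open>(h, k)\<close>.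
\<close>

fun tree_level :: "nat \<Rightarrow> nat \<Rightarrow> nat \<Rightarrow> nat" where
  "tree_level 0 h k = 1"
| "tree_level (Suc m) h k =
     (\<Sum>i=1..h. tree_level m i (Suc k)) + (\<Sum>i=1..k. tree_level m (h + i) (Suc k - i))"

text \<open>
  The hypothesis on weighted sums, for an arbitrary weight \<open>g\<close> of the labels, says that
  the multiset of labels in size \<open>n + 1\<close> arises from that in size \<open>n\<close> by the succession rule.
  Taking \<open>g\<close> to count descendants trades one size for one generation, down to the root.
\<close>

lemma card_eq_tree_level:
  fixes S :: "nat \<Rightarrow> 'a set" and h k :: "'a \<Rightarrow> nat"
  assumes root: "S 1 = {r}" "h r = 1" "k r = 1"
    and rule: "\<And>n (g :: nat \<Rightarrow> nat \<Rightarrow> nat). n \<ge> 1 \<Longrightarrow>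
      (\<Sum>x\<in>S (Suc n). g (h x) (k x)) =
      (\<Sum>x\<in>S n. (\<Sum>i=1..h x. g i (Suc (k x))) + (\<Sum>i=1..k x. g (h x + i) (Suc (k x) - i)))"
    and "n \<ge> 1"
  shows "card (S n) = tree_level (n - 1) 1 1"
proof -
  have "(\<Sum>x\<in>S (Suc n). tree_level m (h x) (k x)) = tree_level (m + n) 1 1" for m n
  proof (induction n arbitrary: m)
    case 0
    then show ?case using root by simp
  next
    case (Suc n)
    have "(\<Sum>x\<in>S (Suc (Suc n)). tree_level m (h x) (k x))
        = (\<Sum>x\<in>S (Suc n). tree_level (Suc m) (h x) (k x))"
      using rule[of "Suc n" "tree_level m"] by simp
    also have "\<dots> = tree_level (m + Suc n) 1 1"
      using Suc[of "Suc m"] by (simp del: tree_level.simps)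
    finally show ?case .
  qed
  from this[of 0 "n - 1"] show ?thesis using \<open>n \<ge> 1\<close> by simp
qed

lemma sum_children:
  assumes "finite X" "\<And>x. x \<in> X \<Longrightarrow> finite (A x)"
    and inj: "inj_on (\<lambda>(x, a). c x a) (Sigma X A)"
    and Y: "Y = (\<lambda>(x, a). c x a) ` Sigma X A"
  shows "sum f Y = (\<Sum>x\<in>X. \<Sum>a\<in>A x. f (c x a))"
proof -
  have "sum f Y = (\<Sum>(x, a)\<in>Sigma X A. f (c x a))"
    unfolding Y sum.reindex[OF inj] by (intro sum.cong) auto
  then show ?thesis using assms(1,2) by (simp add: sum.Sigma)
qed

text \<open>
  The rank \<open>card {t\<in>A. t \<le> a}\<close> runs once through \<open>1, \<dots>, card A\<close>. Labels of children are ranks of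
  the appended value among the admissible ones, and this turns the sum over children
  into the index sums of the succession rule.
\<close>

lemma sum_rank_le:
  fixes A :: "nat set"
  assumes "finite A"
  shows "(\<Sum>a\<in>A. g (card {t\<in>A. t \<le> a})) = (\<Sum>i=1..card A. (g i :: nat))"
  using assms
proof (induction A rule: finite_linorder_max_induct)
  case empty
  then show ?case by simp
next
  case (insert b A)
  have "b \<notin> A" using insert by auto
  have *: "{t. (t = b \<or> t \<in> A) \<and> t \<le> b} = insert b A" using insert by auto
  have "(\<Sum>a\<in>A. g (card {t\<in>insert b A. t \<le> a})) = (\<Sum>a\<in>A. g (card {t\<in>A. t \<le> a}))"
    using insert by (intro sum.cong arg_cong[where f = g] arg_cong[where f = card]) auto
  then show ?case using insert \<open>b \<notin> A\<close> * by simp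
qed

lemma rank_le_plus_rank_ge:
  fixes A :: "nat set"
  assumes "finite A" "a \<in> A"
  shows "card {t\<in>A. t \<le> a} + card {t\<in>A. a \<le> t} = Suc (card A)"
proof -
  have "{t\<in>A. t \<le> a} \<union> {t\<in>A. a \<le> t} = A" "{t\<in>A. t \<le> a} \<inter> {t\<in>A. a \<le> t} = {a}"
    using assms by auto
  then show ?thesis
    using card_Un_Int[of "{t\<in>A. t \<le> a}" "{t\<in>A. a \<le> t}"] assms by simp
qed

lemma sum_rank_ge:
  fixes A :: "nat set"
  assumes "finite A"
  shows "(\<Sum>a\<in>A. g (card {t\<in>A. a \<le> t})) = (\<Sum>i=1..card A. (g i :: nat))"
proof -
  have "(\<Sum>a\<in>A. g (card {t\<in>A. a \<le> t})) = (\<Sum>a\<in>A. g (Suc (card A) - card {t\<in>A. t \<le> a}))"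
  proof (intro sum.cong refl arg_cong[where f = g])
    fix a assume "a \<in> A"
    then show "card {t\<in>A. a \<le> t} = Suc (card A) - card {t\<in>A. t \<le> a}"
      using rank_le_plus_rank_ge[OF assms, of a] by linarith
  qed
  also have "\<dots> = (\<Sum>i=1..card A. g (Suc (card A) - i))"
    by (rule sum_rank_le[OF assms, of "\<lambda>i. g (Suc (card A) - i)"])
  also have "\<dots> = (\<Sum>i=1..card A. g i)"
    by (subst sum.atLeastAtMost_rev) (intro sum.cong arg_cong[where f = g], auto)
  finally show ?thesis .
qed

section \<open>Inversion sequences avoiding 210 and 100\<close>

abbreviation avoiders :: "nat \<Rightarrow> nat list set" where
  "avoiders \<equiv> inversion_sequences_avoiding {[2, 1, 0], [1, 0, 0]}"

text \<open>
  The two patterns differ only in whether the last two letters are equal or descend.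
\<close>

lemma contains_210_or_100_iff:
  "(\<exists>q\<in>{[2, 1, 0], [1, 0, 0]}. contains_pattern e q) \<longleftrightarrow>
     (\<exists>x y z. subseq [x, y, z] e \<and> z \<le> y \<and> y < x)" (is "?L \<longleftrightarrow> ?R")
proof
  have iso: "order_isomorphic [x, y, z] [2, 1, 0] \<longleftrightarrow> z < y \<and> y < x"
    "order_isomorphic [x, y, z] [1, 0, 0] \<longleftrightarrow> z = y \<and> y < x" for x y z
    by (auto simp: order_isomorphic_def All_less_Suc2)
  {
    assume ?L
    then obtain s where s: "subseq s e" "order_isomorphic s [2, 1, 0] \<or> order_isomorphic s [1, 0, 0]"
      unfolding contains_pattern_def by auto
    then have "length s = 3" by (auto simp: order_isomorphic_def)
    then obtain x y z where "s = [x, y, z]"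
      by (auto simp: length_Suc_conv numeral_3_eq_3)
    then show ?R using s iso by (metis less_imp_le order_refl)
  next
    assume ?R
    then show ?L unfolding contains_pattern_def using iso
      by (metis insertI1 insertI2 le_neq_implies_less)
  }
qed

lemma subseq_snoc_iff:
  "subseq (xs @ [x]) (ys @ [y]) \<longleftrightarrow> subseq (xs @ [x]) ys \<or> x = y \<and> subseq xs ys"
proof
  assume "subseq (xs @ [x]) (ys @ [y])"
  then obtain us vs where uv: "xs @ [x] = us @ vs" "subseq us ys" "subseq vs [y]"
    unfolding subseq_append_iff by blast
  show "subseq (xs @ [x]) ys \<or> x = y \<and> subseq xs ys"
  proof (cases vs rule: rev_cases)
    case (snoc ws w)
    then have "length ws = 0" using list_emb_length[OF uv(3)] by simp
    then show ?thesis using snoc uv by (auto simp: subseq_singleton_left)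
  qed (use uv in simp)
next
  assume "subseq (xs @ [x]) ys \<or> x = y \<and> subseq xs ys"
  then show "subseq (xs @ [x]) (ys @ [y])"
    by (auto intro: subseq_rev_drop_many list_emb_append_mono)
qed

definition dips :: "nat list \<Rightarrow> nat set" where
  "dips e = {y. \<exists>x>y. subseq [x, y] e}"

lemma dips_snoc:
  assumes "e \<noteq> []"
  shows "dips (e @ [v]) = dips e \<union> (if v < Max (set e) then {v} else {})"
proof -
  have "subseq [x, y] (e @ [v]) \<longleftrightarrow> subseq [x, y] e \<or> y = v \<and> x \<in> set e" for x y
    using subseq_snoc_iff[of "[x]" y e v] by (simp add: subseq_singleton_left)
  moreover have "v < Max (set e) \<longleftrightarrow> (\<exists>x\<in>set e. v < x)"
    using assms by (simp add: Max_gr_iff)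
  ultimately show ?thesis unfolding dips_def by auto
qed

lemma dips_less_Max: "y \<in> dips e \<Longrightarrow> y < Max (set e)"
proof -
  assume "y \<in> dips e"
  then obtain x where x: "y < x" "subseq [x, y] e" by (auto simp: dips_def)
  then have "x \<in> set e" using list_emb_set[of "(=)" "[x, y]" e x] by auto
  then have "x \<le> Max (set e)" by simp
  then show ?thesis using x by simp
qed

text \<open>
  The admissible new last entries that would become dips.
\<close>

definition low_sites :: "nat list \<Rightarrow> nat set" where
  "low_sites e = {v. v < Max (set e) \<and> (\<forall>y\<in>dips e. y < v)}"

lemma Max_inversion_sequence_less:
  assumes "e \<in> inversion_sequences n" "n \<ge> 1"
  shows "Max (set e) < n"
proof -
  have e: "length e = n" "\<And>i. i < n \<Longrightarrow> e ! i \<le> i"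
    using assms(1) by (auto simp: inversion_sequences_def)
  have "x < n" if "x \<in> set e" for x
    using that e by (metis in_set_conv_nth le_less_trans)
  moreover have "e \<noteq> []" using e assms(2) by auto
  ultimately show ?thesis by simp
qed

lemma snoc_mem_avoiders_iff:
  assumes "n \<ge> 1"
  shows "e @ [v] \<in> avoiders (Suc n) \<longleftrightarrow>
    e \<in> avoiders n \<and> v \<in> low_sites e \<union> {Max (set e)..n}"
proof -
  have inv: "e @ [v] \<in> inversion_sequences (Suc n) \<longleftrightarrow> e \<in> inversion_sequences n \<and> v \<le> n"
    by (auto simp: inversion_sequences_def nth_append less_Suc_eq)
  have *: "subseq [x, y, z] (e @ [v]) \<longleftrightarrow> subseq [x, y, z] e \<or> z = v \<and> subseq [x, y] e" for x y z
    using subseq_snoc_iff[of "[x, y]" z e v] by simp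
  have good: "e \<in> avoiders n \<longleftrightarrow> e \<in> inversion_sequences n \<and>
    \<not> (\<exists>x y z. subseq [x, y, z] e \<and> z \<le> y \<and> y < x)" for e n
    unfolding inversion_sequences_avoiding_def contains_210_or_100_iff[symmetric] by auto
  have "e @ [v] \<in> avoiders (Suc n) \<longleftrightarrow> e \<in> avoiders n \<and> v \<le> n \<and> (\<forall>y\<in>dips e. y < v)"
    unfolding good inv * dips_def by (auto simp: not_le)
  moreover have "v \<le> n \<and> (\<forall>y\<in>dips e. y < v) \<longleftrightarrow> v \<in> low_sites e \<union> {Max (set e)..n}"
    if "e \<in> inversion_sequences n"
  proof -
    have "Max (set e) < n" by (rule Max_inversion_sequence_less[OF that assms])
    then show ?thesis using dips_less_Max[of _ e] by (fastforce simp: low_sites_def)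
  qed
  ultimately show ?thesis using good by blast
qed

lemma finite_low_sites [simp]: "finite (low_sites e)"
  by (rule finite_subset[of _ "{..<Max (set e)}"]) (auto simp: low_sites_def)

lemma finite_avoiders: "finite (avoiders n)"
proof (rule finite_subset)
  show "avoiders n \<subseteq> {xs. set xs \<subseteq> {..n} \<and> length xs = n}"
    by (fastforce simp: inversion_sequences_avoiding_def inversion_sequences_def in_set_conv_nth)
qed (simp add: finite_lists_length_eq)

text \<open>
  For \<open>v\<close> below the maximum the new \<open>h\<close> is the rank of \<open>v\<close> counted from above, and \<open>k\<close> grows
  with the length. For \<open>v = M + i\<close> the values from \<open>M\<close> to \<open>v - 1\<close> join those below the maximum, which
  moves \<open>i\<close> from \<open>k + 1\<close> to \<open>h\<close>. The child with \<open>i = 0\<close> has label \<open>(h, k + 1)\<close> and completes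
  the first half of the succession rule.
\<close>

lemma card_avoiders:
  assumes "n \<ge> 1"
  shows "card (avoiders n) = tree_level (n - 1) 1 1"
proof (rule card_eq_tree_level[where h = "\<lambda>e. Suc (card (low_sites e))"
      and k = "\<lambda>e. length e - Max (set e)" and r = "[0]"])
  have "\<not> subseq [x, y, z] [0]" for x y z :: nat
    using list_emb_length[of "(=)" "[x, y, z]" "[0]"] by auto
  then show "avoiders 1 = {[0]}"
    unfolding inversion_sequences_avoiding_def
    using contains_210_or_100_iff[of "[0]"]
    by (auto simp: inversion_sequences_def length_Suc_conv)
  show "Suc (card (low_sites [0])) = 1" "length [0::nat] - Max (set [0::nat]) = 1"
    by (auto simp: low_sites_def)
next
  fix n :: nat and g :: "nat \<Rightarrow> nat \<Rightarrow> nat"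
  assume n: "n \<ge> 1"
  let ?h = "\<lambda>e. Suc (card (low_sites e))" and ?k = "\<lambda>e. length e - Max (set e)"
  let ?A = "\<lambda>e. low_sites e \<union> {Max (set e)..n}"
  have img: "avoiders (Suc n) = (\<lambda>(e, v). e @ [v]) ` Sigma (avoiders n) ?A"
  proof (intro set_eqI iffI)
    fix e assume e: "e \<in> avoiders (Suc n)"
    then have "length e = Suc n"
      by (simp add: inversion_sequences_avoiding_def inversion_sequences_def)
    then obtain d v where "e = d @ [v]" by (metis length_Suc_conv_rev)
    then show "e \<in> (\<lambda>(e, v). e @ [v]) ` Sigma (avoiders n) ?A"
      using e snoc_mem_avoiders_iff[OF n, of d v] by (auto simp: image_iff)
  qed (use snoc_mem_avoiders_iff[OF n] in auto)
  have "(\<Sum>e\<in>avoiders (Suc n). g (?h e) (?k e))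
      = (\<Sum>e\<in>avoiders n. \<Sum>v\<in>?A e. g (?h (e @ [v])) (?k (e @ [v])))"
    by (rule sum_children[OF finite_avoiders _ _ img]) (auto intro: inj_onI)
  also have "\<dots> = (\<Sum>e\<in>avoiders n. (\<Sum>i=1..?h e. g i (Suc (?k e)))
      + (\<Sum>i=1..?k e. g (?h e + i) (Suc (?k e) - i)))"
  proof (intro sum.cong refl)
    fix e assume e: "e \<in> avoiders n"
    define M where "M = Max (set e)"
    have len: "length e = n" and Mn: "M < n" and ne: "e \<noteq> []"
      using e n Max_inversion_sequence_less[of e n]
      by (auto simp: M_def inversion_sequences_avoiding_def inversion_sequences_def)
    have Max_snoc: "Max (set (e @ [v])) = max M v" for v
      using ne by (simp add: M_def max.commute)
    have low: "?h (e @ [v]) = card {w\<in>low_sites e. v \<le> w} \<and> ?k (e @ [v]) = Suc (?k e)"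
      if v: "v \<in> low_sites e" for v
    proof -
      have vM: "v < M" using v by (simp add: low_sites_def M_def)
      have "low_sites (e @ [v]) = {w\<in>low_sites e. v < w}"
        using v vM unfolding low_sites_def Max_snoc dips_snoc[OF ne] by (auto simp: M_def)
      moreover have "{w\<in>low_sites e. v \<le> w} = insert v {w\<in>low_sites e. v < w}"
        using v by auto
      moreover have "?k (e @ [v]) = Suc (?k e)"
        unfolding Max_snoc using vM Mn len by (simp add: M_def[symmetric])
      ultimately show ?thesis by simp
    qed
    have high: "?h (e @ [v]) = ?h e + (v - M) \<and> ?k (e @ [v]) = Suc (?k e) - (v - M)"
      if v: "v \<in> {M..n}" for v
    proof -
      have "low_sites (e @ [v]) = low_sites e \<union> {M..<v}"
        using v dips_less_Max[of _ e] unfolding low_sites_def Max_snoc dips_snoc[OF ne]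
        by (fastforce simp: M_def[symmetric])
      moreover have "low_sites e \<inter> {M..<v} = {}" by (auto simp: low_sites_def M_def)
      ultimately have "card (low_sites (e @ [v])) = card (low_sites e) + (v - M)"
        by (simp add: card_Un_disjoint)
      then show ?thesis unfolding Max_snoc using v Mn len by (simp add: M_def[symmetric] max_def)
    qed
    (* The summand i = 0 is split off because it is the i = h term of the first sum of the rule. *)
    have "(\<Sum>v\<in>?A e. g (?h (e @ [v])) (?k (e @ [v])))
      = (\<Sum>v\<in>low_sites e. g (?h (e @ [v])) (?k (e @ [v])))
      + (\<Sum>v\<in>{M..n}. g (?h (e @ [v])) (?k (e @ [v])))"
      unfolding M_def by (rule sum.union_disjoint) (auto simp: low_sites_def)
    also have "(\<Sum>v\<in>low_sites e. g (?h (e @ [v])) (?k (e @ [v])))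
      = (\<Sum>v\<in>low_sites e. g (card {w\<in>low_sites e. v \<le> w}) (Suc (?k e)))"
      using low by (intro sum.cong) auto
    also have "\<dots> = (\<Sum>i=1..card (low_sites e). g i (Suc (?k e)))"
      by (rule sum_rank_ge[where g = "\<lambda>i. g i (Suc (?k e))"]) simp
    also have "(\<Sum>v\<in>{M..n}. g (?h (e @ [v])) (?k (e @ [v])))
      = (\<Sum>v\<in>{M..n}. g (?h e + (v - M)) (Suc (?k e) - (v - M)))"
      using high by (intro sum.cong) auto
    also have "\<dots> = (\<Sum>i=0..?k e. g (?h e + i) (Suc (?k e) - i))"
      using Mn len by (intro sum.reindex_bij_witness[of _ "\<lambda>i. i + M" "\<lambda>v. v - M"])
        (auto simp: M_def[symmetric])
    also have "\<dots> = g (?h e) (Suc (?k e)) + (\<Sum>i=1..?k e. g (?h e + i) (Suc (?k e) - i))"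
      by (simp add: sum.atLeast_Suc_atMost)
    finally show "(\<Sum>v\<in>?A e. g (?h (e @ [v])) (?k (e @ [v])))
      = (\<Sum>i=1..?h e. g i (Suc (?k e))) + (\<Sum>i=1..?k e. g (?h e + i) (Suc (?k e) - i))"
      by simp
  qed
  finally show "(\<Sum>e\<in>avoiders (Suc n). g (?h e) (?k e)) = \<dots>" .
qed (fact assms)

section \<open>Growing a permutation at its right end\<close>

definition lift :: "nat \<Rightarrow> nat \<Rightarrow> nat" where
  "lift a x = (if x < a then x else Suc x)"

text \<open>
  The adjoint of \<open>lift a\<close>: comparing \<open>lift a x\<close> with \<open>s\<close> amounts to comparing \<open>x\<close> with
  \<open>unlift a s\<close>. Hence a site \<open>s\<close> of the grown permutation inherits its constraints from the site
  \<open>unlift a s\<close>, and both \<open>a\<close> and \<open>a + 1\<close> come from \<open>a\<close>.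
\<close>

definition unlift :: "nat \<Rightarrow> nat \<Rightarrow> nat" where
  "unlift a s = (if s \<le> a then s else s - 1)"

lemma lift_less_iff: "lift a x < s \<longleftrightarrow> x < unlift a s"
  by (auto simp: lift_def unlift_def)

lemma le_lift_iff: "s \<le> lift a x \<longleftrightarrow> unlift a s \<le> x"
  using lift_less_iff[of a x s] by (simp add: not_less[symmetric])

lemma lift_less_lift_iff [simp]: "lift a x < lift a y \<longleftrightarrow> x < y"
  by (auto simp: lift_def)

lemma inj_lift: "inj (lift a)"
  by (auto simp: inj_def lift_def split: if_splits)

lemma lift_neq [simp]: "lift a x \<noteq> a" "a \<noteq> lift a x"
  by (auto simp: lift_def)

definition grow :: "nat list \<Rightarrow> nat \<Rightarrow> nat list" where
  "grow p a = map (lift a) p @ [a]"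

lemma grow_inject: "grow p a = grow q b \<longleftrightarrow> p = q \<and> a = b"
  using inj_lift[of a] by (auto simp: grow_def dest: map_injective)

lemma lift_image:
  assumes "1 \<le> a" "a \<le> Suc n"
  shows "lift a ` {1..n} = {1..Suc n} - {a}"
proof (intro set_eqI iffI)
  fix x assume x: "x \<in> {1..Suc n} - {a}"
  have "x = lift a (unlift a x)" "unlift a x \<in> {1..n}"
    using x assms by (auto simp: lift_def unlift_def)
  then show "x \<in> lift a ` {1..n}" by blast
qed (use assms in \<open>auto simp: lift_def\<close>)

lemma permutations_Suc:
  "permutations_of_set {1..Suc n} =
     (\<lambda>(p, a). grow p a) ` (permutations_of_set {1..n} \<times> {1..Suc n})"
proof (intro set_eqI iffI)
  fix q assume q: "q \<in> permutations_of_set {1..Suc n}"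
  then have "q \<noteq> []" by (auto simp: permutations_of_set_def)
  then obtain r a where r: "q = r @ [a]" by (metis rev_exhaust)
  have a: "a \<in> {1..Suc n}" and dr: "distinct r" and sr: "set r = {1..Suc n} - {a}"
    using q r by (auto simp: permutations_of_set_def)
  have "r \<in> lists (lift a ` {1..n})" using lift_image[of a n] a sr by auto
  then obtain p where p: "r = map (lift a) p" "p \<in> lists {1..n}"
    unfolding lists_image by auto
  have "lift a ` set p = lift a ` {1..n}" using p sr lift_image[of a n] a by auto
  then have "set p = {1..n}" using inj_lift inj_image_eq_iff by metis
  moreover have "distinct p" using dr p by (simp add: distinct_map)
  ultimately have "p \<in> permutations_of_set {1..n}" by (simp add: permutations_of_set_def)
  then show "q \<in> (\<lambda>(p, a). grow p a) ` (permutations_of_set {1..n} \<times> {1..Suc n})"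
    using r p a by (force simp: grow_def)
next
  fix q assume "q \<in> (\<lambda>(p, a). grow p a) ` (permutations_of_set {1..n} \<times> {1..Suc n})"
  then obtain p a where q: "q = grow p a" "distinct p" "set p = {1..n}" "a \<in> {1..Suc n}"
    by (auto simp: permutations_of_set_def)
  have "set q = {1..Suc n}" using q lift_image[of a n] by (auto simp: grow_def)
  moreover have "distinct q"
    using q inj_on_subset[OF inj_lift subset_UNIV, of a "{1..n}"]
    by (auto simp: grow_def distinct_map)
  ultimately show "q \<in> permutations_of_set {1..Suc n}" by (simp add: permutations_of_set_def)
qed

section \<open>Active sites for the patterns 2-14-3 and 2-41-3\<close>

text \<open>
  In both patterns the two middle letters are adjacent positions and carry the lowest and the
  highest value; \<open>up\<close> tells whether they ascend (2-14-3) or descend (2-41-3).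
\<close>

definition bottom :: "bool \<Rightarrow> nat list \<Rightarrow> nat \<Rightarrow> nat" where
  "bottom up p j = (if up then p ! j else p ! Suc j)"

definition top_of :: "bool \<Rightarrow> nat list \<Rightarrow> nat \<Rightarrow> nat" where
  "top_of up p j = (if up then p ! Suc j else p ! j)"

definition vincular_avoiders :: "bool \<Rightarrow> nat \<Rightarrow> nat list set" where
  "vincular_avoiders up n = {p \<in> permutations_of_set {1..n}.
     \<not> (\<exists>i j k. i < j \<and> Suc j < k \<and> k < n \<and>
          bottom up p j < p ! i \<and> p ! i < p ! k \<and> p ! k < top_of up p j)}"

text \<open>
  The site \<open>s\<close> cannot be appended: the entries at \<open>i\<close>, \<open>j\<close>, \<open>j + 1\<close> would form the pattern with it.
  The upper inequality is not strict because entries equal to \<open>s\<close> are raised above it.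
\<close>

definition blocked :: "bool \<Rightarrow> nat list \<Rightarrow> nat \<Rightarrow> bool" where
  "blocked up p s \<longleftrightarrow> (\<exists>i j. i < j \<and> Suc j < length p \<and>
     bottom up p j < p ! i \<and> p ! i < s \<and> s \<le> top_of up p j)"

definition sites :: "bool \<Rightarrow> nat list \<Rightarrow> nat set" where
  "sites up p = {s \<in> {1..Suc (length p)}. \<not> blocked up p s}"

lemma finite_sites [simp]: "finite (sites up p)"
  by (simp add: sites_def)

lemma grow_nth: "i < length p \<Longrightarrow> grow p a ! i = lift a (p ! i)"
  "grow p a ! length p = a" "length (grow p a) = Suc (length p)"
  by (auto simp: grow_def nth_append)

lemma bottom_top_grow:
  assumes "Suc j < length p"
  shows "bottom up (grow p a) j = lift a (bottom up p j)"
    "top_of up (grow p a) j = lift a (top_of up p j)"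
  using assms by (auto simp: bottom_def top_of_def grow_nth)

lemma grow_mem_vincular_avoiders_iff:
  assumes p: "p \<in> permutations_of_set {1..n}" and a: "a \<in> {1..Suc n}"
  shows "grow p a \<in> vincular_avoiders up (Suc n) \<longleftrightarrow>
    p \<in> vincular_avoiders up n \<and> a \<in> sites up p"
proof -
  have len: "length p = n" using p by (simp add: length_finite_permutations_of_set)
  let ?q = "grow p a"
  let ?bad = "\<lambda>p n. (\<exists>i j k. i < j \<and> Suc j < k \<and> k < n \<and>
          bottom up p j < p ! i \<and> p ! i < p ! k \<and> p ! k < top_of up p j)"
  have ua: "unlift a a = a" by (simp add: unlift_def)
  have "a < lift a x \<longleftrightarrow> a \<le> x" for x by (auto simp: lift_def)
  then have last: "bottom up ?q j < ?q ! i \<and> ?q ! i < ?q ! n \<and> ?q ! n < top_of up ?q j \<longleftrightarrow>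
      bottom up p j < p ! i \<and> p ! i < a \<and> a \<le> top_of up p j" if "i < j" "Suc j < n" for i j
    using that by (simp add: bottom_top_grow len grow_nth(1) grow_nth(2)[of p, unfolded len]
        lift_less_iff ua del: lift_less_lift_iff) (simp add: lift_less_iff[symmetric])
  have inner: "bottom up ?q j < ?q ! i \<and> ?q ! i < ?q ! k \<and> ?q ! k < top_of up ?q j \<longleftrightarrow>
      bottom up p j < p ! i \<and> p ! i < p ! k \<and> p ! k < top_of up p j"
    if "i < j" "Suc j < k" "k < n" for i j k
    using that by (simp add: bottom_top_grow len grow_nth(1))
  have "?bad ?q (Suc n) \<longleftrightarrow> ?bad ?q n \<or> (\<exists>i j. i < j \<and> Suc j < n \<and>
      bottom up ?q j < ?q ! i \<and> ?q ! i < ?q ! n \<and> ?q ! n < top_of up ?q j)"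
    unfolding less_Suc_eq[of _ n] by blast
  also have "?bad ?q n \<longleftrightarrow> ?bad p n" using inner by blast
  also have "(\<exists>i j. i < j \<and> Suc j < n \<and>
      bottom up ?q j < ?q ! i \<and> ?q ! i < ?q ! n \<and> ?q ! n < top_of up ?q j) \<longleftrightarrow> blocked up p a"
    unfolding blocked_def len using last by blast
  finally have "?bad ?q (Suc n) \<longleftrightarrow> ?bad p n \<or> blocked up p a" .
  moreover have "?q \<in> permutations_of_set {1..Suc n}"
    unfolding permutations_Suc using p a by blast
  ultimately show ?thesis using p a len by (auto simp: vincular_avoiders_def sites_def)
qed

lemma vincular_avoiders_Suc:
  "vincular_avoiders up (Suc n) = (\<lambda>(p, a). grow p a) ` Sigma (vincular_avoiders up n) (sites up)"
proof (intro set_eqI iffI)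
  fix q assume q: "q \<in> vincular_avoiders up (Suc n)"
  then have "q \<in> permutations_of_set {1..Suc n}" by (simp add: vincular_avoiders_def)
  then obtain p a where "q = grow p a" "p \<in> permutations_of_set {1..n}" "a \<in> {1..Suc n}"
    unfolding permutations_Suc by auto
  then show "q \<in> (\<lambda>(p, a). grow p a) ` Sigma (vincular_avoiders up n) (sites up)"
    using q grow_mem_vincular_avoiders_iff by blast
next
  fix q assume "q \<in> (\<lambda>(p, a). grow p a) ` Sigma (vincular_avoiders up n) (sites up)"
  then obtain p a where q: "q = grow p a" "p \<in> vincular_avoiders up n" "a \<in> sites up p" by auto
  then have p: "p \<in> permutations_of_set {1..n}" by (simp add: vincular_avoiders_def)
  then have "a \<in> {1..Suc n}" using q by (auto simp: sites_def length_finite_permutations_of_set)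
  then show "q \<in> vincular_avoiders up (Suc n)" using grow_mem_vincular_avoiders_iff[OF p] q by blast
qed

lemma sum_vincular_avoiders_Suc:
  "sum f (vincular_avoiders up (Suc n)) =
     (\<Sum>p\<in>vincular_avoiders up n. \<Sum>a\<in>sites up p. f (grow p a))"
proof (rule sum_children[OF _ _ _ vincular_avoiders_Suc])
  show "finite (vincular_avoiders up n)" by (simp add: vincular_avoiders_def)
qed (auto intro: inj_onI simp: grow_inject)

text \<open>
  The obstructions either lie inside the old permutation or use the new adjacency of the old last
  entry with \<open>a\<close>; in the second case \<open>x\<close> plays the letter 2.
\<close>

lemma blocked_grow:
  assumes "p \<noteq> []"
  shows "blocked up (grow p a) s \<longleftrightarrow> blocked up p (unlift a s) \<or>
    (\<exists>x\<in>set (butlast p). (if up then lift a (last p) else a) < lift a x \<and> lift a x < s \<and>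
       s \<le> (if up then a else lift a (last p)))"
proof -
  obtain r l where p: "p = r @ [l]" using assms by (metis rev_exhaust)
  let ?q = "grow p a" and ?m = "length r"
  let ?P = "\<lambda>p i j s. bottom up p j < p ! i \<and> p ! i < s \<and> s \<le> top_of up p j"
  have inner: "?P ?q i j s \<longleftrightarrow> ?P p i j (unlift a s)" if "i < j" "Suc j < length p" for i j
    using that by (simp add: bottom_top_grow grow_nth(1) lift_less_iff[where s = s] le_lift_iff[of s a])
  have at: "?q ! ?m = lift a l" "?q ! Suc ?m = a"
    using grow_nth(1)[of ?m p a] grow_nth(2)[of p a] by (auto simp: p)
  have outer: "?P ?q i ?m s \<longleftrightarrow> (if up then lift a l else a) < lift a (r ! i) \<and>
      lift a (r ! i) < s \<and> s \<le> (if up then a else lift a l)" if "i < ?m" for i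
    using that at grow_nth(1)[of i p a] by (simp add: bottom_def top_of_def p nth_append)
  have "blocked up ?q s \<longleftrightarrow> (\<exists>i j. i < j \<and> Suc j < length p \<and> ?P ?q i j s) \<or> (\<exists>i<?m. ?P ?q i ?m s)"
    unfolding blocked_def grow_nth(3) by (auto simp: p less_Suc_eq)
  also have "\<dots> \<longleftrightarrow> blocked up p (unlift a s) \<or> (\<exists>i<?m. ?P ?q i ?m s)"
    unfolding blocked_def using inner by blast
  also have "(\<exists>i<?m. ?P ?q i ?m s) \<longleftrightarrow> (\<exists>x\<in>set r. (if up then lift a l else a) < lift a x \<and>
      lift a x < s \<and> s \<le> (if up then a else lift a l))"
    using outer by (metis in_set_conv_nth)
  finally show ?thesis by (simp add: p)
qed

lemma set_butlast_permutation:
  assumes "p \<in> permutations_of_set {1..n}" "p \<noteq> []"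
  shows "set (butlast p) = {1..n} - {last p}" "last p \<in> {1..n}"
proof -
  obtain r l where "p = r @ [l]" using assms by (metis rev_exhaust)
  then show "set (butlast p) = {1..n} - {last p}" "last p \<in> {1..n}"
    using assms by (auto simp: permutations_of_set_def)
qed

text \<open>
  The new adjacency blocks \<open>s\<close> iff some entry lies strictly between the old last entry and \<open>s \<le> a\<close>.
  All values occur in a permutation, so \<open>last p + 1\<close> is such an entry once there is room for it.
\<close>

lemma sites_grow_up:
  assumes p: "p \<in> permutations_of_set {1..n}" "p \<noteq> []" and a: "a \<in> sites True p"
  shows "sites True (grow p a) =
    {s \<in> {1..Suc (Suc n)}. unlift a s \<in> sites True p \<and> \<not> (last p + 2 \<le> s \<and> s \<le> a)}"
proof -
  have len: "length p = n" using p by (simp add: length_finite_permutations_of_set)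
  note bl = set_butlast_permutation[OF p]
  have a': "1 \<le> a" "a \<le> Suc n" using a len by (auto simp: sites_def)
  have "(\<exists>x\<in>set (butlast p). lift a (last p) < lift a x \<and> lift a x < s \<and> s \<le> a) \<longleftrightarrow>
      last p + 2 \<le> s \<and> s \<le> a" (is "?L \<longleftrightarrow> ?R") for s
  proof
    assume ?R
    then have "Suc (last p) \<in> set (butlast p)" "lift a (Suc (last p)) < s"
      using bl a' by (auto simp: lift_def)
    then show ?L using \<open>?R\<close> by (intro bexI[of _ "Suc (last p)"]) auto
  qed (auto simp: lift_def split: if_splits)
  moreover have "unlift a s \<in> {1..Suc n}" if "s \<in> {1..Suc (Suc n)}" for s
    using that a' by (auto simp: unlift_def)
  ultimately show ?thesis
    unfolding sites_def grow_nth(3) using blocked_grow[OF p(2), of True a] len by auto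
qed

text \<open>
  Here the new adjacency descends from the raised last entry to \<open>a\<close>, and the old entry
  with value \<open>a\<close>, raised to \<open>a + 1\<close>, is the smallest one that can play the letter 2.
\<close>

lemma sites_grow_down:
  assumes p: "p \<in> permutations_of_set {1..n}" "p \<noteq> []" and a: "a \<in> sites False p"
  shows "sites False (grow p a) =
    {s \<in> {1..Suc (Suc n)}. unlift a s \<in> sites False p \<and> \<not> (a + 2 \<le> s \<and> s \<le> Suc (last p))}"
proof -
  have len: "length p = n" using p by (simp add: length_finite_permutations_of_set)
  note bl = set_butlast_permutation[OF p]
  have a': "1 \<le> a" "a \<le> Suc n" using a len by (auto simp: sites_def)
  have "(\<exists>x\<in>set (butlast p). a < lift a x \<and> lift a x < s \<and> s \<le> lift a (last p)) \<longleftrightarrow>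
      a + 2 \<le> s \<and> s \<le> Suc (last p)" (is "?L \<longleftrightarrow> ?R") for s
  proof
    assume ?R
    then have "a \<in> set (butlast p)" "lift a a = Suc a" "lift a (last p) = Suc (last p)"
      using bl a' by (auto simp: lift_def)
    then show ?L using \<open>?R\<close> by (intro bexI[of _ a]) auto
  qed (auto simp: lift_def split: if_splits)
  moreover have "unlift a s \<in> {1..Suc n}" if "s \<in> {1..Suc (Suc n)}" for s
    using that a' by (auto simp: unlift_def)
  ultimately show ?thesis
    unfolding sites_def grow_nth(3) using blocked_grow[OF p(2), of False a] len by auto
qed

lemma last_grow [simp]: "last (grow p a) = a"
  by (simp add: grow_def)

text \<open>
  A value just above the last entry would complete a pattern only if the last entry did so already.
\<close>

lemma Suc_last_mem_sites:
  assumes p: "p \<in> permutations_of_set {1..n}" "p \<noteq> []" and av: "p \<in> vincular_avoiders True n"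
  shows "Suc (last p) \<in> sites True p"
proof -
  have len: "length p = n" using p by (simp add: length_finite_permutations_of_set)
  have dist: "distinct p" using p by (simp add: permutations_of_set_def)
  have n: "n \<ge> 1" using p len by (cases p) auto
  have lst: "last p = p ! (n - 1)" using p len by (simp add: last_conv_nth)
  have "\<not> blocked True p (Suc (last p))"
  proof
    assume "blocked True p (Suc (last p))"
    then obtain i j where ij: "i < j" "Suc j < n" "p ! j < p ! i" "p ! i \<le> last p" "last p < p ! Suc j"
      by (auto simp: blocked_def bottom_def top_of_def len)
    have "Suc j \<noteq> n - 1" using ij lst by auto
    moreover have "p ! i \<noteq> last p" using ij lst nth_eq_iff_index_eq[OF dist, of i "n - 1"] len by auto
    ultimately have "i < j \<and> Suc j < n - 1 \<and> n - 1 < n \<and> bottom True p j < p ! i \<and>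
        p ! i < p ! (n - 1) \<and> p ! (n - 1) < top_of True p j"
      using ij lst by (auto simp: bottom_def top_of_def)
    then show False using av unfolding vincular_avoiders_def by blast
  qed
  then show ?thesis using set_butlast_permutation(2)[OF p] len by (auto simp: sites_def)
qed

section \<open>Plane and semi-Baxter permutations follow the rule\<close>

definition sites_le :: "bool \<Rightarrow> nat list \<Rightarrow> nat set" where
  "sites_le up p = {s\<in>sites up p. s \<le> last p}"

definition sites_gt :: "bool \<Rightarrow> nat list \<Rightarrow> nat set" where
  "sites_gt up p = {s\<in>sites up p. last p < s}"

lemma finite_sites_le_gt [simp]: "finite (sites_le up p)" "finite (sites_gt up p)"
  by (auto simp: sites_le_def sites_gt_def)

lemma sum_sites_split:
  "(\<Sum>a\<in>sites up p. f a) = (\<Sum>a\<in>sites_le up p. f a) + (\<Sum>a\<in>sites_gt up p. (f a :: nat))"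
proof -
  have "sites up p = sites_le up p \<union> sites_gt up p" "sites_le up p \<inter> sites_gt up p = {}"
    by (auto simp: sites_le_def sites_gt_def)
  then show ?thesis by (simp add: sum.union_disjoint)
qed

lemma card_sites: "card (sites up p) = card (sites_le up p) + card (sites_gt up p)"
  using sum_sites_split[of "\<lambda>_. 1" up p] by simp

lemma sites_bounds: "length p = n \<Longrightarrow> s \<in> sites up p \<Longrightarrow> 1 \<le> s \<and> s \<le> Suc n"
  by (simp add: sites_def)

lemma card_sites_gt_grow:
  assumes "sites_gt up (grow p a) = Suc ` {t\<in>sites up p. a \<le> t}"
  shows "card (sites_gt up (grow p a)) = card {t\<in>sites up p. a \<le> t}"
  unfolding assms by (rule card_image) auto

lemma vincular_avoiders_one: "vincular_avoiders up 1 = {[1]}"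
  by (auto simp: vincular_avoiders_def)

lemma sites_single: "sites up [1] = {1, 2}"
  by (auto simp: sites_def blocked_def)

lemma sites_split_single:
  "card (sites_le up [1]) = 1" "card (sites_gt up [1]) = 1"
proof -
  have "sites_le up [1] = {1}" "sites_gt up [1] = {2}"
    unfolding sites_le_def sites_gt_def sites_single by auto
  then show "card (sites_le up [1]) = 1" "card (sites_gt up [1]) = 1" by auto
qed

text \<open>
  Rank sums over the sites above the last entry, counted from the top; there the rank among
  all sites is the rank among those above the last entry.
\<close>

lemma sum_high_sites:
  "(\<Sum>a\<in>sites_gt up p. g (card {t\<in>sites up p. a \<le> t})) = (\<Sum>i=1..card (sites_gt up p). (g i :: nat))"
proof -
  have "(\<Sum>a\<in>sites_gt up p. g (card {t\<in>sites up p. a \<le> t}))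
     = (\<Sum>a\<in>sites_gt up p. g (card {t\<in>sites_gt up p. a \<le> t}))"
    by (intro sum.cong refl arg_cong[where f = g] arg_cong[where f = card]) (auto simp: sites_gt_def)
  then show ?thesis using sum_rank_ge[of "sites_gt up p" g] by simp
qed

lemma sum_low_sites:
  "(\<Sum>a\<in>sites_le up p. g (card {t\<in>sites up p. t \<le> a})) = (\<Sum>i=1..card (sites_le up p). (g i :: nat))"
proof -
  have "(\<Sum>a\<in>sites_le up p. g (card {t\<in>sites up p. t \<le> a}))
     = (\<Sum>a\<in>sites_le up p. g (card {t\<in>sites_le up p. t \<le> a}))"
    by (intro sum.cong refl arg_cong[where f = g] arg_cong[where f = card]) (auto simp: sites_le_def)
  then show ?thesis using sum_rank_le[of "sites_le up p" g] by simp
qed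

lemma vincular_avoiders_facts:
  assumes "p \<in> vincular_avoiders up n" "n \<ge> 1"
  shows "p \<in> permutations_of_set {1..n}" "length p = n" "p \<noteq> []" "last p \<in> {1..n}"
proof -
  show p: "p \<in> permutations_of_set {1..n}" using assms by (simp add: vincular_avoiders_def)
  then show len: "length p = n" by (simp add: length_finite_permutations_of_set)
  then show "p \<noteq> []" using assms by auto
  then show "last p \<in> {1..n}" using set_butlast_permutation(2)[OF p] by blast
qed

text \<open>
  Appending \<open>a > last p\<close> leaves at or below \<open>a\<close> only the old low sites and \<open>last p + 1\<close>, so \<open>k\<close> grows
  by one while \<open>h\<close> becomes the rank of \<open>a\<close> from above. Appending \<open>a \<le> last p\<close> kills no site, and
  the \<open>h + k + 1\<close> sites are merely cut anew at \<open>a\<close>.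
\<close>

lemma card_vincular_avoiders_up:
  assumes "n \<ge> 1"
  shows "card (vincular_avoiders True n) = tree_level (n - 1) 1 1"
proof (rule card_eq_tree_level[where h = "\<lambda>p. card (sites_gt True p)"
      and k = "\<lambda>p. card (sites_le True p)" and r = "[1]"])
  fix n :: nat and g :: "nat \<Rightarrow> nat \<Rightarrow> nat"
  assume n: "n \<ge> 1"
  let ?h = "\<lambda>p. card (sites_gt True p)" and ?k = "\<lambda>p. card (sites_le True p)"
  have "(\<Sum>a\<in>sites True p. g (?h (grow p a)) (?k (grow p a)))
      = (\<Sum>i=1..?h p. g i (Suc (?k p))) + (\<Sum>i=1..?k p. g (?h p + i) (Suc (?k p) - i))"
    if av: "p \<in> vincular_avoiders True n" for p
  proof -
    note p = vincular_avoiders_facts[OF av n]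
    note bd = sites_bounds[OF p(2)]
    note grow = sites_grow_up[OF p(1,3)]
    have gt: "?h (grow p a) = card {t\<in>sites True p. a \<le> t}" if a: "a \<in> sites True p" for a
    proof (rule card_sites_gt_grow, intro set_eqI iffI)
      fix s assume "s \<in> sites_gt True (grow p a)"
      then have s: "a < s" "s - 1 \<in> sites True p"
        unfolding sites_gt_def grow[OF a] by (auto simp: unlift_def)
      then show "s \<in> Suc ` {t\<in>sites True p. a \<le> t}" by (intro image_eqI[of _ _ "s - 1"]) auto
    qed (use bd in \<open>auto simp: sites_gt_def grow[OF a] unlift_def\<close>)
    have le_low: "sites_le True (grow p a) = {t\<in>sites True p. t \<le> a}"
      if a: "a \<in> sites True p" "a \<le> last p" for a
      using a bd unfolding sites_le_def grow[OF a(1)] by (fastforce simp: unlift_def)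
    have le_high: "?k (grow p a) = Suc (?k p)"
      if a: "a \<in> sites True p" "last p < a" for a
    proof -
      have "sites_le True (grow p a) = insert (Suc (last p)) (sites_le True p)"
        using a bd Suc_last_mem_sites[OF p(1,3) av]
        unfolding sites_le_def grow[OF a(1)] by (fastforce simp: unlift_def le_Suc_eq)
      then show ?thesis by (simp add: sites_le_def)
    qed
    have "(\<Sum>a\<in>sites_gt True p. g (?h (grow p a)) (?k (grow p a)))
       = (\<Sum>a\<in>sites_gt True p. g (card {t\<in>sites True p. a \<le> t}) (Suc (?k p)))"
      using gt le_high by (intro sum.cong) (auto simp: sites_gt_def)
    then have 1: "(\<Sum>a\<in>sites_gt True p. g (?h (grow p a)) (?k (grow p a))) = (\<Sum>i=1..?h p. g i (Suc (?k p)))"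
      using sum_high_sites[of "\<lambda>i. g i (Suc (?k p))"] by simp
    have "(\<Sum>a\<in>sites_le True p. g (?h (grow p a)) (?k (grow p a)))
       = (\<Sum>a\<in>sites_le True p. g (Suc (?h p + ?k p) - card {t\<in>sites True p. t \<le> a})
            (card {t\<in>sites True p. t \<le> a}))"
    proof (intro sum.cong refl arg_cong2[where f = g])
      fix a assume "a \<in> sites_le True p"
      then have a: "a \<in> sites True p" "a \<le> last p" by (auto simp: sites_le_def)
      show "?h (grow p a) = Suc (?h p + ?k p) - card {t\<in>sites True p. t \<le> a}"
        using gt[OF a(1)] rank_le_plus_rank_ge[OF finite_sites a(1)] card_sites[of True p] by simp
      show "?k (grow p a) = card {t\<in>sites True p. t \<le> a}" using le_low[OF a] by simp
    qed
    also have "\<dots> = (\<Sum>i=1..?k p. g (Suc (?h p + ?k p) - i) i)"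
      by (rule sum_low_sites)
    also have "\<dots> = (\<Sum>i=1..?k p. g (?h p + i) (Suc (?k p) - i))"
      by (subst sum.atLeastAtMost_rev) (intro sum.cong arg_cong2[where f = g], auto)
    finally show ?thesis using 1 by (simp add: sum_sites_split)
  qed
  then show "(\<Sum>p\<in>vincular_avoiders True (Suc n). g (?h p) (?k p))
      = (\<Sum>p\<in>vincular_avoiders True n. (\<Sum>i=1..?h p. g i (Suc (?k p)))
         + (\<Sum>i=1..?k p. g (?h p + i) (Suc (?k p) - i)))"
    unfolding sum_vincular_avoiders_Suc by (intro sum.cong) auto
qed (use assms sites_split_single vincular_avoiders_one in auto)

text \<open>
  Appending \<open>a \<le> last p\<close> leaves above \<open>a\<close> only \<open>a + 1\<close> and the shifted old high sites, so \<open>k\<close>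
  grows by one while \<open>h\<close> becomes the rank of \<open>a\<close>. Appending \<open>a > last p\<close> kills no site, and the
  \<open>h + k + 1\<close> sites are cut anew at \<open>a\<close>.
\<close>

lemma card_vincular_avoiders_down:
  assumes "n \<ge> 1"
  shows "card (vincular_avoiders False n) = tree_level (n - 1) 1 1"
proof (rule card_eq_tree_level[where h = "\<lambda>p. card (sites_le False p)"
      and k = "\<lambda>p. card (sites_gt False p)" and r = "[1]"])
  fix n :: nat and g :: "nat \<Rightarrow> nat \<Rightarrow> nat"
  assume n: "n \<ge> 1"
  let ?h = "\<lambda>p. card (sites_le False p)" and ?k = "\<lambda>p. card (sites_gt False p)"
  have "(\<Sum>a\<in>sites False p. g (?h (grow p a)) (?k (grow p a)))
      = (\<Sum>i=1..?h p. g i (Suc (?k p))) + (\<Sum>i=1..?k p. g (?h p + i) (Suc (?k p) - i))"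
    if av: "p \<in> vincular_avoiders False n" for p
  proof -
    note p = vincular_avoiders_facts[OF av n]
    note bd = sites_bounds[OF p(2)]
    note grow = sites_grow_down[OF p(1,3)]
    have le: "?h (grow p a) = card {t\<in>sites False p. t \<le> a}" if a: "a \<in> sites False p" for a
    proof -
      have "sites_le False (grow p a) = {t\<in>sites False p. t \<le> a}"
        using a bd unfolding sites_le_def grow[OF a(1)] by (fastforce simp: unlift_def)
      then show ?thesis by simp
    qed
    have gt_high: "?k (grow p a) = card {t\<in>sites False p. a \<le> t}"
      if a: "a \<in> sites False p" "last p < a" for a
    proof (rule card_sites_gt_grow, intro set_eqI iffI)
      fix s assume "s \<in> sites_gt False (grow p a)"
      then have s: "a < s" "s - 1 \<in> sites False p"
        unfolding sites_gt_def grow[OF a(1)] by (auto simp: unlift_def)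
      then show "s \<in> Suc ` {t\<in>sites False p. a \<le> t}" by (intro image_eqI[of _ _ "s - 1"]) auto
    qed (use a bd in \<open>auto simp: sites_gt_def grow[OF a(1)] unlift_def\<close>)
    have gt_low: "?k (grow p a) = Suc (?k p)"
      if a: "a \<in> sites False p" "a \<le> last p" for a
    proof -
      have "sites_gt False (grow p a) = Suc ` insert a (sites_gt False p)"
      proof (intro set_eqI iffI)
        fix s assume "s \<in> sites_gt False (grow p a)"
        then have s: "a < s" "s - 1 \<in> sites False p" "s = Suc a \<or> Suc (last p) < s"
          unfolding sites_gt_def grow[OF a(1)] by (auto simp: unlift_def)
        then show "s \<in> Suc ` insert a (sites_gt False p)"
          by (intro image_eqI[of _ _ "s - 1"]) (auto simp: sites_gt_def)
      qed (use a bd in \<open>auto simp: sites_gt_def grow[OF a(1)] unlift_def\<close>)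
      then have "?k (grow p a) = card (insert a (sites_gt False p))"
        by (simp only: card_image[OF inj_on_subset[OF inj_Suc subset_UNIV]])
      then show ?thesis using a by (simp add: sites_gt_def)
    qed
    have "(\<Sum>a\<in>sites_le False p. g (?h (grow p a)) (?k (grow p a)))
       = (\<Sum>a\<in>sites_le False p. g (card {t\<in>sites False p. t \<le> a}) (Suc (?k p)))"
      using le gt_low by (intro sum.cong) (auto simp: sites_le_def)
    then have 1: "(\<Sum>a\<in>sites_le False p. g (?h (grow p a)) (?k (grow p a))) = (\<Sum>i=1..?h p. g i (Suc (?k p)))"
      using sum_low_sites[of "\<lambda>i. g i (Suc (?k p))"] by simp
    have "(\<Sum>a\<in>sites_gt False p. g (?h (grow p a)) (?k (grow p a)))
       = (\<Sum>a\<in>sites_gt False p. g (Suc (?h p + ?k p) - card {t\<in>sites False p. a \<le> t})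
            (card {t\<in>sites False p. a \<le> t}))"
    proof (intro sum.cong refl arg_cong2[where f = g])
      fix a assume "a \<in> sites_gt False p"
      then have a: "a \<in> sites False p" "last p < a" by (auto simp: sites_gt_def)
      show "?h (grow p a) = Suc (?h p + ?k p) - card {t\<in>sites False p. a \<le> t}"
        using le[OF a(1)] rank_le_plus_rank_ge[OF finite_sites a(1)] card_sites[of False p] by simp
      show "?k (grow p a) = card {t\<in>sites False p. a \<le> t}" using gt_high[OF a] .
    qed
    also have "\<dots> = (\<Sum>i=1..?k p. g (Suc (?h p + ?k p) - i) i)"
      by (rule sum_high_sites)
    also have "\<dots> = (\<Sum>i=1..?k p. g (?h p + i) (Suc (?k p) - i))"
      by (subst sum.atLeastAtMost_rev) (intro sum.cong arg_cong2[where f = g], auto)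
    finally show ?thesis using 1 by (simp add: sum_sites_split)
  qed
  then show "(\<Sum>p\<in>vincular_avoiders False (Suc n). g (?h p) (?k p))
      = (\<Sum>p\<in>vincular_avoiders False n. (\<Sum>i=1..?h p. g i (Suc (?k p)))
         + (\<Sum>i=1..?k p. g (?h p + i) (Suc (?k p) - i)))"
    unfolding sum_vincular_avoiders_Suc by (intro sum.cong) auto
qed (use assms sites_split_single vincular_avoiders_one in auto)

section \<open>Equality of the three counts\<close>

theorem theorem9:
  fixes n :: nat
  assumes "n \<ge> 1"
  shows "card (inversion_sequences_avoiding {[2, 1, 0], [1, 0, 0]} n) = card (plane_permutations n)
       \<and> card (inversion_sequences_avoiding {[2, 1, 0], [1, 0, 0]} n) = SB n"
proof -
  have "plane_permutations n = vincular_avoiders True n"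
    "semi_baxter_permutations n = vincular_avoiders False n"
    by (auto simp: plane_permutations_def semi_baxter_permutations_def vincular_avoiders_def
        bottom_def top_of_def)
  then show ?thesis
    using card_avoiders[OF assms] card_vincular_avoiders_up[OF assms]
      card_vincular_avoiders_down[OF assms]
    by (simp add: SB_def)
qed

end
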